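(* Let $(X,d)$ be a geodesic metric space. Then $X$ has non-negative curvature if and only if $X$ satisfies the $2$-fork inequality with constant $K=1$.
   Context: A geodesic metric space $(X,d)$ has **non-negative curvature** if for all $x,y,z\in X$ and every midpoint $m_{xy}$ of $x$ and $y$, $$2d(z,m_{xy})^2+\frac{d(x,y)^2}{2}\ge d(z,x)^2+d(z,y)^2 .$$ A metric space $(X,d)$ satisfies the **$p$-fork inequality with constant $K>0$** if for all $w,x,y,z\in X$, $$\frac{2^{-p}d(w,x)^p}{2}+\frac{2^{-p}d(w,y)^p}{2}+\frac{d(x,y)^p}{(4K)^p}\le\frac12d(z,w)^p+\frac14d(z,x)^p+\frac14d(z,y)^p .$$ Thus the $2$-fork inequality with constant $K=1$ reads $\frac18d(w,x)^2+\frac18d(w,y)^2+\frac1{16}d(x,y)^2\le\frac12d(z,w)^2+\frac14d(z,x)^2+\frac14d(z,y)^2$ for all $w,x,y,z\in X$. *)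

theory Defs
  imports "HOL-Analysis.Analysis"
begin

definition geodesic_between :: "'a set \<Rightarrow> ('a \<Rightarrow> 'a \<Rightarrow> real) \<Rightarrow> (real \<Rightarrow> 'a) \<Rightarrow> 'a \<Rightarrow> 'a \<Rightarrow> bool" where
  "geodesic_between X d \<gamma> x y \<longleftrightarrow>
     \<gamma> \<in> {0..d x y} \<rightarrow> X \<and> \<gamma> 0 = x \<and> \<gamma> (d x y) = y \<and>
     (\<forall>s\<in>{0..d x y}. \<forall>t\<in>{0..d x y}. d (\<gamma> s) (\<gamma> t) = \<bar>s - t\<bar>)"

definition geodesic_metric_space :: "'a set \<Rightarrow> ('a \<Rightarrow> 'a \<Rightarrow> real) \<Rightarrow> bool" where
  "geodesic_metric_space X d \<longleftrightarrow>
     Metric_space X d \<and> (\<forall>x\<in>X. \<forall>y\<in>X. \<exists>\<gamma>. geodesic_between X d \<gamma> x y)"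

definition metric_midpoint :: "'a set \<Rightarrow> ('a \<Rightarrow> 'a \<Rightarrow> real) \<Rightarrow> 'a \<Rightarrow> 'a \<Rightarrow> 'a \<Rightarrow> bool" where
  "metric_midpoint X d x y m \<longleftrightarrow> m \<in> X \<and> d x m = d x y / 2 \<and> d y m = d x y / 2"

definition nonneg_curvature :: "'a set \<Rightarrow> ('a \<Rightarrow> 'a \<Rightarrow> real) \<Rightarrow> bool" where
  "nonneg_curvature X d \<longleftrightarrow>
     (\<forall>x\<in>X. \<forall>y\<in>X. \<forall>z\<in>X. \<forall>m. metric_midpoint X d x y m \<longrightarrow>
        2 * (d z m)\<^sup>2 + (d x y)\<^sup>2 / 2 \<ge> (d z x)\<^sup>2 + (d z y)\<^sup>2)"

(* Distances are nonnegative; 0 powr p = 0, so this is the usual power only for p > 0. *)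
definition fork_inequality :: "'a set \<Rightarrow> ('a \<Rightarrow> 'a \<Rightarrow> real) \<Rightarrow> real \<Rightarrow> real \<Rightarrow> bool" where
  "fork_inequality X d p K \<longleftrightarrow> K > 0 \<and>
     (\<forall>w\<in>X. \<forall>x\<in>X. \<forall>y\<in>X. \<forall>z\<in>X.
        (2 powr (- p) * d w x powr p) / 2 + (2 powr (- p) * d w y powr p) / 2
          + d x y powr p / (4 * K) powr p
        \<le> 1/2 * d z w powr p + 1/4 * d z x powr p + 1/4 * d z y powr p)"

end

theory Submission imports Defs begin

text \<open>
  After clearing denominators the fork inequality says that
  \<open>2 d(w,x)\<^sup>2 + 2 d(w,y)\<^sup>2 + d(x,y)\<^sup>2 \<le> 8 d(z,w)\<^sup>2 + 4 d(z,x)\<^sup>2 + 4 d(z,y)\<^sup>2\<close>; in a Hilbert space the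
  difference of the two sides is \<open>\<bar>2 w + x + y - 4 z\<bar>\<^sup>2\<close>.

  From fork to curvature: let \<open>m\<close> be a midpoint of \<open>x\<close>, \<open>y\<close>, let
  \<open>E(w) = d(w,x)\<^sup>2 + d(w,y)\<^sup>2 - 2 d(w,m)\<^sup>2 - d(x,y)\<^sup>2 / 2\<close>, and let \<open>c\<close> be a midpoint of \<open>m\<close>, \<open>w\<close>.
  The fork inequality centred at \<open>c\<close>, its equality case in a Hilbert space, gives \<open>E(w) \<le> 2 E(c)\<close>,
  while the one centred at \<open>m\<close> gives \<open>E(w) \<le> 2 d(w,m)\<^sup>2\<close>. Iterating the first \<open>n\<close> times
  along a geodesic from \<open>w\<close> to \<open>m\<close> and then using the second yields
  \<open>E(w) \<le> 2 d(w,m)\<^sup>2 / 2\<^sup>n\<close>.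

  From curvature to fork: if \<open>z\<close> is a midpoint of \<open>w\<close> and some \<open>v\<close>, comparison for \<open>x\<close> and \<open>y\<close>
  against \<open>w\<close>, \<open>v\<close> and \<open>d(x,y)\<^sup>2 \<le> 2 d(v,x)\<^sup>2 + 2 d(v,y)\<^sup>2\<close> give the inequality. In general such
  a \<open>v\<close> need not exist, so \<open>z\<close> is moved slightly towards \<open>w\<close> to a point \<open>c\<close>; then \<open>z\<close> itself
  serves as \<open>v\<close> for the fork contracted towards \<open>c\<close> by \<open>2\<^sup>-\<^sup>n\<close>. Under non-negative
  curvature contraction by \<open>2\<^sup>-\<^sup>n\<close> shrinks distances by at most that factor, so the inequality
  for the contracted fork implies it for the full one, and \<open>c\<close> tends to \<open>z\<close>.
\<close>

lemma geodesic_betweenD: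
  assumes "geodesic_between X d \<gamma> x y"
  shows "\<And>t. 0 \<le> t \<Longrightarrow> t \<le> d x y \<Longrightarrow> \<gamma> t \<in> X" "\<gamma> 0 = x" "\<gamma> (d x y) = y"
    "\<And>s t. 0 \<le> s \<Longrightarrow> s \<le> d x y \<Longrightarrow> 0 \<le> t \<Longrightarrow> t \<le> d x y \<Longrightarrow> d (\<gamma> s) (\<gamma> t) = \<bar>s - t\<bar>"
  using assms by (auto simp: geodesic_between_def Pi_iff)

lemma divide_two_power_le: "a / 2^n \<le> a" if "0 \<le> a" for a :: real
  using that by (simp add: divide_le_eq mult_le_cancel_left1)

context Metric_space
begin

lemma fork_inequality_2_1_iff:
  "fork_inequality M d 2 1 \<longleftrightarrow>
    (\<forall>w\<in>M. \<forall>x\<in>M. \<forall>y\<in>M. \<forall>z\<in>M.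
      2 * (d w x)\<^sup>2 + 2 * (d w y)\<^sup>2 + (d x y)\<^sup>2 \<le> 8 * (d z w)\<^sup>2 + 4 * (d z x)\<^sup>2 + 4 * (d z y)\<^sup>2)"
proof -
  have quarter: "(2::real) powr (-2) = 1/4" by (simp add: powr_minus)
  have "2 powr (-2) * d w x powr 2 / 2 + 2 powr (-2) * d w y powr 2 / 2
        + d x y powr 2 / (4 * 1) powr 2
      \<le> 1/2 * d z w powr 2 + 1/4 * d z x powr 2 + 1/4 * d z y powr 2 \<longleftrightarrow>
      2 * (d w x)\<^sup>2 + 2 * (d w y)\<^sup>2 + (d x y)\<^sup>2 \<le> 8 * (d z w)\<^sup>2 + 4 * (d z x)\<^sup>2 + 4 * (d z y)\<^sup>2"
    for w x y z unfolding quarter by (simp add: field_simps) linarith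
  then show ?thesis unfolding fork_inequality_def by simp
qed

lemma metric_midpoint_geodesic:
  assumes "geodesic_between M d \<gamma> x y" "0 \<le> r" "r \<le> t" "t \<le> d x y"
  shows "metric_midpoint M d (\<gamma> r) (\<gamma> t) (\<gamma> ((r + t) / 2))"
  using geodesic_betweenD(1,4)[OF assms(1)] assms(2-)
  by (auto simp: metric_midpoint_def field_simps)

lemma geodesic_between_tail:
  assumes \<gamma>: "geodesic_between M d \<gamma> x y" and "0 \<le> r" "r \<le> d x y" and "y \<in> M"
  shows "d (\<gamma> r) y = d x y - r" "geodesic_between M d (\<lambda>t. \<gamma> (r + t)) (\<gamma> r) y"
proof -
  note G = geodesic_betweenD[OF \<gamma>]
  show len: "d (\<gamma> r) y = d x y - r"
    using G(4)[of r "d x y"] G(3) assms(2,3) by simp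
  show "geodesic_between M d (\<lambda>t. \<gamma> (r + t)) (\<gamma> r) y"
    unfolding geodesic_between_def len using G assms(2,3) by auto
qed

section \<open>From the fork inequality to non-negative curvature\<close>

lemma fork_imp_midpoint_ineq:
  assumes fork: "\<And>w x y z. \<lbrakk>w \<in> M; x \<in> M; y \<in> M; z \<in> M\<rbrakk> \<Longrightarrow>
      2 * (d w x)\<^sup>2 + 2 * (d w y)\<^sup>2 + (d x y)\<^sup>2 \<le> 8 * (d z w)\<^sup>2 + 4 * (d z x)\<^sup>2 + 4 * (d z y)\<^sup>2"
    and \<sigma>: "geodesic_between M d \<sigma> m w"
    and M: "x \<in> M" "y \<in> M" "w \<in> M" and mid: "metric_midpoint M d x y m"
  shows "(d w x)\<^sup>2 + (d w y)\<^sup>2 \<le> 2 * (d w m)\<^sup>2 + (d x y)\<^sup>2 / 2"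
proof -
  define D where "D = d m w"
  define E where "E s = (d (\<sigma> s) x)\<^sup>2 + (d (\<sigma> s) y)\<^sup>2 - 2 * s\<^sup>2 - (d x y)\<^sup>2 / 2" for s
  note G = geodesic_betweenD[OF \<sigma>, folded D_def]
  have m: "m \<in> M" "d m x = d x y / 2" "d m y = d x y / 2"
    using mid by (auto simp: metric_midpoint_def commute)
  have D0: "0 \<le> D" by (simp add: D_def)
  \<comment> \<open>The \<open>s\<^sup>2\<close> terms cancel exactly, so no error accumulates under
    iteration.\<close>
  have halve: "E s \<le> 2 * E (s / 2)" if "0 \<le> s" "s \<le> D" for s
  proof -
    have half: "d (\<sigma> (s/2)) (\<sigma> s) = s / 2" using G(4)[of "s/2" s] that by simp
    show ?thesis
      using fork[of "\<sigma> s" x y "\<sigma> (s/2)"] G(1)[of s] G(1)[of "s/2"] M that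
      by (simp add: half E_def power_divide)
  qed
  have quadratic: "E s \<le> 2 * s\<^sup>2" if "0 \<le> s" "s \<le> D" for s
  proof -
    have "d m (\<sigma> s) = s" using G(4)[of 0 s] G(2) that by simp
    then show ?thesis
      using fork[of "\<sigma> s" x y m] G(1)[of s] M m that
      by (simp add: E_def power_divide)
  qed
  have scale: "0 \<le> D / 2^n" "D / 2^n \<le> D" for n :: nat
    using D0 by (simp_all add: divide_two_power_le)
  have iter: "E D \<le> 2^n * E (D / 2^n)" for n :: nat
  proof (induction n)
    case (Suc n)
    note Suc.IH
    also have "2^n * E (D / 2^n) \<le> 2^n * (2 * E (D / 2^n / 2))"
      using halve[OF scale, of n] by (intro mult_left_mono) auto
    also have "\<dots> = 2^Suc n * E (D / 2^Suc n)" by (simp add: mult_ac)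
    finally show ?case .
  qed simp
  \<comment> \<open>The quadratic bound shrinks by \<open>4^n\<close>, which beats the factor
    \<open>2^n\<close> from the halvings.\<close>
  have "E D \<le> 2 * D\<^sup>2 * (1/2)^n" for n :: nat
  proof -
    have "2^n * E (D / 2^n) \<le> 2^n * (2 * (D / 2^n)\<^sup>2)"
      using quadratic[OF scale, of n] by (intro mult_left_mono) auto
    also have "\<dots> = 2 * D\<^sup>2 * (1/2)^n"
      by (simp add: power2_eq_square field_simps)
    finally show ?thesis using iter[of n] by simp
  qed
  moreover have "(\<lambda>n. 2 * D\<^sup>2 * (1/2)^n) \<longlonglongrightarrow> 2 * D\<^sup>2 * 0"
    by (intro tendsto_intros LIMSEQ_power_zero) simp
  ultimately have "E D \<le> 2 * D\<^sup>2 * 0" by (intro LIMSEQ_le_const) auto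
  moreover have "d w m = D" by (simp add: D_def commute)
  ultimately show ?thesis using G(3) by (simp add: E_def)
qed

section \<open>From non-negative curvature to the fork inequality\<close>

lemma fork_if_opposite_point:
  assumes nnc: "nonneg_curvature M d" and mid: "metric_midpoint M d v w z"
    and M: "v \<in> M" "w \<in> M" "x \<in> M" "y \<in> M"
  shows "2 * (d w x)\<^sup>2 + 2 * (d w y)\<^sup>2 + (d x y)\<^sup>2 \<le> 8 * (d z w)\<^sup>2 + 4 * (d z x)\<^sup>2 + 4 * (d z y)\<^sup>2"
proof -
  have comparison: "(d v u)\<^sup>2 + (d w u)\<^sup>2 \<le> 2 * (d z u)\<^sup>2 + 2 * (d z w)\<^sup>2" if "u \<in> M" for u
  proof -
    have vw: "d v w = 2 * d z w" using mid by (simp add: metric_midpoint_def commute)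
    have "(d u v)\<^sup>2 + (d u w)\<^sup>2 \<le> 2 * (d u z)\<^sup>2 + (d v w)\<^sup>2 / 2"
      using nnc mid M that unfolding nonneg_curvature_def by blast
    then show ?thesis by (simp add: vw commute[of u] power_mult_distrib)
  qed
  have "(d x y)\<^sup>2 \<le> (d v x + d v y)\<^sup>2"
    using triangle[of x v y] M by (intro power_mono) (auto simp: commute)
  also have "\<dots> \<le> 2 * (d v x)\<^sup>2 + 2 * (d v y)\<^sup>2"
    using sum_squares_bound[of "d v x" "d v y"] by (simp add: power2_sum)
  finally show ?thesis using comparison[of x] comparison[of y] M by simp
qed

text \<open>Compare \<open>y\<close> with the midpoint \<open>m\<close>, then \<open>m\<close> with
  the midpoint \<open>n\<close>. Adding the first to twice the second eliminates
  \<open>d y m\<close>, and the terms in \<open>d c x\<close> and \<open>d c y\<close>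
  cancel.\<close>

lemma nonneg_curvature_midpoint_contraction:
  assumes nnc: "nonneg_curvature M d" and M: "c \<in> M" "x \<in> M" "y \<in> M"
    and m: "metric_midpoint M d c x m" and n: "metric_midpoint M d c y n"
  shows "d x y \<le> 2 * d m n"
proof -
  have mn: "m \<in> M" "n \<in> M" using m n by (auto simp: metric_midpoint_def)
  have "(d y c)\<^sup>2 + (d y x)\<^sup>2 \<le> 2 * (d y m)\<^sup>2 + (d c x)\<^sup>2 / 2"
    "(d m c)\<^sup>2 + (d m y)\<^sup>2 \<le> 2 * (d m n)\<^sup>2 + (d c y)\<^sup>2 / 2"
    using nnc M m n mn unfolding nonneg_curvature_def by blast+
  moreover have mc: "d m c = d c x / 2" using m by (simp add: metric_midpoint_def commute)
  ultimately have "(d x y)\<^sup>2 \<le> (2 * d m n)\<^sup>2"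
    unfolding mc by (simp add: commute[of y] power_divide power_mult_distrib)
  then show ?thesis by (rule power2_le_imp_le) simp
qed

lemma nonneg_curvature_dyadic_contraction:
  fixes n :: nat
  assumes nnc: "nonneg_curvature M d"
    and \<alpha>: "geodesic_between M d \<alpha> c x" and \<beta>: "geodesic_between M d \<beta> c y"
  shows "d x y \<le> 2^n * d (\<alpha> (d c x / 2^n)) (\<beta> (d c y / 2^n))"
proof (induction n)
  case 0
  then show ?case using geodesic_betweenD(3)[OF \<alpha>] geodesic_betweenD(3)[OF \<beta>] by simp
next
  case (Suc n)
  have half: "metric_midpoint M d c (\<gamma> (d c u / 2^n)) (\<gamma> (d c u / 2^Suc n))"
    "c \<in> M" "\<gamma> (d c u / 2^n) \<in> M"
    if \<gamma>: "geodesic_between M d \<gamma> c u" for \<gamma> u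
  proof -
    have "0 \<le> d c u / 2^n" "d c u / 2^n \<le> d c u"
      by (simp_all add: divide_two_power_le)
    then show "metric_midpoint M d c (\<gamma> (d c u / 2^n)) (\<gamma> (d c u / 2^Suc n))"
      "c \<in> M" "\<gamma> (d c u / 2^n) \<in> M"
      using metric_midpoint_geodesic[OF \<gamma>, of 0 "d c u / 2^n"] geodesic_betweenD[OF \<gamma>]
      by (auto simp: mult.commute dest: geodesic_betweenD(1)[OF \<gamma>, of 0])
  qed
  note Suc.IH
  also have "2^n * d (\<alpha> (d c x / 2^n)) (\<beta> (d c y / 2^n))
      \<le> 2^n * (2 * d (\<alpha> (d c x / 2^Suc n)) (\<beta> (d c y / 2^Suc n)))"
    using nonneg_curvature_midpoint_contraction[OF nnc] half[OF \<alpha>] half[OF \<beta>]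
    by (intro mult_left_mono) auto
  finally show ?case by (simp add: mult_ac)
qed

lemma fork_near_center:
  fixes n :: nat
  assumes geo: "geodesic_metric_space M d" and nnc: "nonneg_curvature M d"
    and M: "w \<in> M" "x \<in> M" "y \<in> M" "z \<in> M"
  obtains c where "c \<in> M" "d z c \<le> d z w / 2^n"
    "2 * (d w x)\<^sup>2 + 2 * (d w y)\<^sup>2 + (d x y)\<^sup>2 \<le> 8 * (d c w)\<^sup>2 + 4 * (d c x)\<^sup>2 + 4 * (d c y)\<^sup>2"
proof -
  obtain \<gamma> where \<gamma>: "geodesic_between M d \<gamma> z w"
    using geo M by (auto simp: geodesic_metric_space_def)
  note G = geodesic_betweenD[OF \<gamma>]
  \<comment> \<open>solves \<open>\<epsilon> = (d z w - \<epsilon>) / 2^n\<close>, so that contracting \<open>w\<close> towards \<open>c\<close> lands opposite to \<open>z\<close>\<close>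
  define \<epsilon> where "\<epsilon> = d z w / (2^n + 1)"
  define c where "c = \<gamma> \<epsilon>"
  have pow: "(1::real) \<le> 2^n" by simp
  have p0: "(0::real) < 2^n + 1" by (simp add: add_pos_pos)
  have "\<epsilon> * (2^n + 1) = d z w" using p0 by (simp add: \<epsilon>_def)
  then have eq: "\<epsilon> * 2^n + \<epsilon> = d z w" by (simp add: distrib_left)
  have \<epsilon>0: "0 \<le> \<epsilon>" using p0 by (simp add: \<epsilon>_def)
  have \<epsilon>le: "2 * \<epsilon> \<le> d z w"
    using eq mult_left_mono[OF pow \<epsilon>0] by simp
  have small: "\<epsilon> \<le> d z w / 2^n" using eq \<epsilon>0 by (simp add: field_simps)
  have cM: "c \<in> M" unfolding c_def using G(1) \<epsilon>0 \<epsilon>le by simp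
  have zc: "d z c = \<epsilon>" unfolding c_def using G(4)[of 0 \<epsilon>] G(2) \<epsilon>0 \<epsilon>le by simp
  \<comment> \<open>The contraction of \<open>w\<close> has to follow \<open>\<gamma>\<close>
    itself: along another geodesic from \<open>c\<close> to \<open>w\<close>, \<open>c\<close> might
    not be a midpoint of \<open>z\<close> and the contracted point.\<close>
  have tail: "d c w = d z w - \<epsilon>" "geodesic_between M d (\<lambda>t. \<gamma> (\<epsilon> + t)) c w"
    using geodesic_between_tail[OF \<gamma>, of \<epsilon>] \<epsilon>0 \<epsilon>le M unfolding c_def by auto
  have cw: "d c w / 2^n = \<epsilon>" using eq tail(1) by (simp add: field_simps)
  obtain \<alpha> \<beta> where \<alpha>: "geodesic_between M d \<alpha> c x" and \<beta>: "geodesic_between M d \<beta> c y"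
    using geo M cM by (meson geodesic_metric_space_def)
  define w' where "w' = \<gamma> (2 * \<epsilon>)"
  define x' where "x' = \<alpha> (d c x / 2^n)"
  define y' where "y' = \<beta> (d c y / 2^n)"
  have mid: "metric_midpoint M d z w' c"
    using metric_midpoint_geodesic[OF \<gamma>, of 0 "2 * \<epsilon>"] G(2) \<epsilon>0 \<epsilon>le by (simp add: w'_def c_def)
  have le: "d c u / 2^n \<le> d c u" for u
    by (simp add: divide_two_power_le)
  have M': "w' \<in> M" "x' \<in> M" "y' \<in> M"
    unfolding w'_def x'_def y'_def
    using G(1) \<epsilon>0 \<epsilon>le geodesic_betweenD(1)[OF \<alpha>] geodesic_betweenD(1)[OF \<beta>] le by simp_all
  have "d z w' = 2 * \<epsilon>"
    using G(4)[of 0 "2 * \<epsilon>"] G(2) \<epsilon>0 \<epsilon>le by (simp add: w'_def)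
  then have radii: "d c w' = d c w / 2^n" "d c x' = d c x / 2^n" "d c y' = d c y / 2^n"
    using mid cw geodesic_betweenD(2,4)[OF \<alpha>] geodesic_betweenD(2,4)[OF \<beta>] le
      geodesic_betweenD(4)[OF \<alpha>, of 0 "d c x / 2^n"] geodesic_betweenD(4)[OF \<beta>, of 0 "d c y / 2^n"]
    by (simp_all add: x'_def y'_def metric_midpoint_def commute[of c w'])
  have dist: "d w x \<le> 2^n * d w' x'" "d w y \<le> 2^n * d w' y'" "d x y \<le> 2^n * d x' y'"
    using nonneg_curvature_dyadic_contraction[OF nnc tail(2) \<alpha>, of n]
      nonneg_curvature_dyadic_contraction[OF nnc tail(2) \<beta>, of n]
      nonneg_curvature_dyadic_contraction[OF nnc \<alpha> \<beta>, of n]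
    by (simp_all add: cw w'_def x'_def y'_def)
  \<comment> \<open>Both sides of the fork inequality are homogeneous of degree 2, so the factor
    \<open>(2^n)\<^sup>2\<close> lost by contracting on the left is regained exactly from the radii
    at \<open>c\<close>.\<close>
  have "2 * (d w x)\<^sup>2 + 2 * (d w y)\<^sup>2 + (d x y)\<^sup>2
      \<le> 2 * (2^n * d w' x')\<^sup>2 + 2 * (2^n * d w' y')\<^sup>2 + (2^n * d x' y')\<^sup>2"
    using dist by (intro add_mono mult_left_mono power_mono) auto
  also have "\<dots> = (2^n)\<^sup>2 * (2 * (d w' x')\<^sup>2 + 2 * (d w' y')\<^sup>2 + (d x' y')\<^sup>2)"
    by (simp add: power_mult_distrib algebra_simps)
  also have "\<dots> \<le> (2^n)\<^sup>2 * (8 * (d c w')\<^sup>2 + 4 * (d c x')\<^sup>2 + 4 * (d c y')\<^sup>2)"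
    using fork_if_opposite_point[OF nnc mid \<open>z \<in> M\<close> M'] by (intro mult_left_mono) auto
  also have "\<dots> = 8 * (d c w)\<^sup>2 + 4 * (d c x)\<^sup>2 + 4 * (d c y)\<^sup>2"
    by (simp add: radii power_divide field_simps)
  finally show thesis using that cM zc small by simp
qed

lemma nonneg_curvature_imp_fork:
  assumes geo: "geodesic_metric_space M d" and nnc: "nonneg_curvature M d"
    and M: "w \<in> M" "x \<in> M" "y \<in> M" "z \<in> M"
  shows "2 * (d w x)\<^sup>2 + 2 * (d w y)\<^sup>2 + (d x y)\<^sup>2 \<le> 8 * (d z w)\<^sup>2 + 4 * (d z x)\<^sup>2 + 4 * (d z y)\<^sup>2"
proof -
  define r where "r n = d z w * (1/2)^n" for n :: nat
  have "2 * (d w x)\<^sup>2 + 2 * (d w y)\<^sup>2 + (d x y)\<^sup>2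
      \<le> 8 * (d z w + r n)\<^sup>2 + 4 * (d z x + r n)\<^sup>2 + 4 * (d z y + r n)\<^sup>2" for n
  proof -
    obtain c where c: "c \<in> M" "d z c \<le> d z w / 2^n"
      "2 * (d w x)\<^sup>2 + 2 * (d w y)\<^sup>2 + (d x y)\<^sup>2 \<le> 8 * (d c w)\<^sup>2 + 4 * (d c x)\<^sup>2 + 4 * (d c y)\<^sup>2"
      using fork_near_center[OF geo nnc M] .
    have "d z c \<le> r n" using c(2) by (simp add: r_def power_divide)
    then have "d c u \<le> d z u + r n" if "u \<in> M" for u
      using triangle[of c z u] c(1) M that by (simp add: commute)
    then have "8 * (d c w)\<^sup>2 + 4 * (d c x)\<^sup>2 + 4 * (d c y)\<^sup>2
        \<le> 8 * (d z w + r n)\<^sup>2 + 4 * (d z x + r n)\<^sup>2 + 4 * (d z y + r n)\<^sup>2"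
      using M by (intro add_mono mult_left_mono power_mono) auto
    with c(3) show ?thesis by linarith
  qed
  moreover have "r \<longlonglongrightarrow> d z w * 0"
    unfolding r_def by (intro tendsto_intros LIMSEQ_power_zero) simp
  then have "(\<lambda>n. 8 * (d z w + r n)\<^sup>2 + 4 * (d z x + r n)\<^sup>2 + 4 * (d z y + r n)\<^sup>2) \<longlonglongrightarrow>
      8 * (d z w + d z w * 0)\<^sup>2 + 4 * (d z x + d z w * 0)\<^sup>2 + 4 * (d z y + d z w * 0)\<^sup>2"
    by (intro tendsto_intros)
  ultimately show ?thesis by (intro LIMSEQ_le_const[where x = "_ + _"]) auto
qed

end

theorem theoremD:
  fixes X :: "'a set" and d :: "'a \<Rightarrow> 'a \<Rightarrow> real"
  assumes "geodesic_metric_space X d"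
  shows "nonneg_curvature X d \<longleftrightarrow> fork_inequality X d 2 1"
proof -
  interpret Metric_space X d using assms by (simp add: geodesic_metric_space_def)
  show ?thesis
  proof
    assume "nonneg_curvature X d"
    then show "fork_inequality X d 2 1"
      unfolding fork_inequality_2_1_iff using nonneg_curvature_imp_fork[OF assms] by blast
  next
    assume fork: "fork_inequality X d 2 1"
    show "nonneg_curvature X d"
      unfolding nonneg_curvature_def
    proof (intro ballI allI impI)
      fix x y z m
      assume M: "x \<in> X" "y \<in> X" "z \<in> X" and mid: "metric_midpoint X d x y m"
      obtain \<sigma> where "geodesic_between X d \<sigma> m z"
        using assms M mid by (meson geodesic_metric_space_def metric_midpoint_def)
      then show "(d z x)\<^sup>2 + (d z y)\<^sup>2 \<le> 2 * (d z m)\<^sup>2 + (d x y)\<^sup>2 / 2"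
        using fork_imp_midpoint_ineq[OF _ _ M mid] fork[unfolded fork_inequality_2_1_iff]
        by blast
    qed
  qed
qed

end
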